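(* Let $n\ge 2$. Any element $\boldsymbol{p}$ of $\mathbb{S}(n,N)$ can be written in the form $$\boldsymbol{p}=\sum_{j=1}^{n}S_j\boldsymbol{r}_j,$$ where, for each $j\in\{1,\dots,n\}$, $S_j$ is a scalar polynomial and $\boldsymbol{r}_j$ is the $j$-th generator of $\mathbb{S}(n,N)$.
   Context: Fix $n\in\mathbb{N}$ and $N\in\mathbb{N}$ (positive integers). $\mathbb{P}$ is the space of $n$-dimensional vector polynomials $\boldsymbol{p}(z)=(P_1(z),\dots,P_n(z))^t$, where each $P_k$ is a scalar polynomial with complex coefficients. It is a complex vector space and a module over the ring of scalar polynomials. Height: for nonzero $\boldsymbol{p}\in\mathbb{P}$, $h(\boldsymbol{p}):=\max_{j\in\{1,\dots,n\}}\{n\deg P_j+j-1\}$ with $\deg 0=-\infty$; and $h(0):=-\infty$. For a subset $\mathcal{M}\subset\mathbb{P}$ containing a nonzero element, $h(\mathcal{M}):=\min\{h(\boldsymbol{q}):\boldsymbol{q}\in\mathcal{M},\ \boldsymbol{q}\neq 0\}$. Interpolation problem: given are nodes $z_1,\dots,z_N\in\mathbb{C}$, not necessarily pairwise different, and complex numbers $\alpha_k(j)$ ($k=1,\dots,n$, $j=1,\dots,N$) with $\sum_{k=1}^n|\alpha_k(j)|>0$ for every $j$. Standing assumption: the vectors $\boldsymbol{\alpha}(j)=(\alpha_1(j),\dots,\alpha_n(j))^t$ belonging to coinciding nodes are linearly independent (i.e. for each $w\in\mathbb{C}$ the family $\{\boldsymbol{\alpha}(j): z_j=w\}$, indexed by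 $j$, is linearly independent). $\mathbb{S}(n,N)$ denotes the set of all $\boldsymbol{p}\in\mathbb{P}$ such that $\sum_{k=1}^n\alpha_k(j)P_k(z_j)=0$ for all $j\in\{1,\dots,N\}$. Generators: for $\boldsymbol{r}\in\mathbb{P}$ let $\mathbb{M}(\boldsymbol{r}):=\{S\boldsymbol{r}: S \text{ a scalar polynomial}\}$. A first generator of $\mathbb{S}(n,N)$ is an element $\boldsymbol{r}_1\in\mathbb{S}(n,N)$ with $h(\boldsymbol{r}_1)=h(\mathbb{S}(n,N))$; put $\mathbb{M}_1:=\mathbb{M}(\boldsymbol{r}_1)$. Recursively, for $1<j\le n$, the $j$-th generator is a vector polynomial $\boldsymbol{r}_j\in\mathbb{S}(n,N)\setminus[\mathbb{M}_1+\dots+\mathbb{M}_{j-1}]$ (this set is nonempty and the sum is direct) such that $h(\boldsymbol{r}_j)=h(\mathbb{S}(n,N)\setminus[\mathbb{M}_1+\dots+\mathbb{M}_{j-1}])$; put $\mathbb{M}_j:=\mathbb{M}(\boldsymbol{r}_j)$. *)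

theory Defs
  imports
    Complex_Main
    "HOL-Computational_Algebra.Polynomial"
    "HOL-Library.Function_Algebras"
    "HOL-Library.Set_Algebras"
    "HOL-Library.Extended_Real"
begin

text \<open>
  An \<open>n\<close>-dimensional vector polynomial is a function on component indices \<open>1, \<dots>, n\<close>,
  extended by \<open>0\<close> to all other indices, so that equality, addition and finite sums of vector
  polynomials are those of functions (from \<^theory>\<open>HOL-Library.Function_Algebras\<close>).
\<close>

type_synonym vec_poly = "nat \<Rightarrow> complex poly"

definition vec_polys :: "nat \<Rightarrow> vec_poly set" where
  "vec_polys n = {p. \<forall>k. k \<notin> {1..n} \<longrightarrow> p k = 0}"

definition vp_scale :: "complex poly \<Rightarrow> vec_poly \<Rightarrow> vec_poly" where
  "vp_scale S p = (\<lambda>k. S * p k)"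

text \<open>The library's \<^const>\<open>degree\<close> has \<open>degree 0 = 0\<close>; here the zero polynomial has degree \<open>-\<infinity>\<close>.\<close>

definition ext_degree :: "complex poly \<Rightarrow> ereal" where
  "ext_degree P = (if P = 0 then -\<infinity> else ereal (real (degree P)))"

definition height :: "nat \<Rightarrow> vec_poly \<Rightarrow> ereal" where
  "height n p =
     Max ((\<lambda>j. ereal (real n) * ext_degree (p j) + ereal (real j) - 1) ` {1..n})"

text \<open>The extended-real arithmetic already yields height \<open>-\<infinity>\<close> for the zero vector polynomial.\<close>

lemma height_zero:
  assumes "n \<ge> 1"
  shows "height n 0 = -\<infinity>"
proof -
  have minf: "-\<infinity> - (1 :: ereal) = -\<infinity>"
    unfolding one_ereal_def by (rule ereal_minus)
  have "(\<lambda>j. ereal (real n) * ext_degree ((0 :: vec_poly) j) + ereal (real j) - 1) ` {1..n}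
      = (\<lambda>j. -\<infinity>) ` {1..n}"
    using assms by (intro image_cong) (simp_all add: ext_degree_def minf)
  also have "\<dots> = {-\<infinity>}"
    using assms by auto
  finally show ?thesis
    by (simp add: height_def)
qed

text \<open>
  The minimum of the heights of the nonzero elements, meaningful only if \<open>M\<close> has a nonzero
  element. (\<^const>\<open>Min\<close> would require a finite set.)
\<close>

definition set_height :: "nat \<Rightarrow> vec_poly set \<Rightarrow> ereal" where
  "set_height n M = (LEAST x. x \<in> height n ` (M - {0}))"

text \<open>
  Linear independence over the complex numbers, as vectors with components \<open>1, \<dots>, n\<close>, of the
  family \<open>v\<close> indexed by the finite set \<open>J\<close>; in particular, repeated vectors are dependent.
\<close>

definition lin_indep_family :: "nat \<Rightarrow> 'i set \<Rightarrow> ('i \<Rightarrow> nat \<Rightarrow> complex) \<Rightarrow> bool" where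
  "lin_indep_family n J v \<longleftrightarrow>
     (\<forall>c :: 'i \<Rightarrow> complex.
        (\<forall>k\<in>{1..n}. (\<Sum>j\<in>J. c j * v j k) = 0) \<longrightarrow> (\<forall>j\<in>J. c j = 0))"

text \<open>The solution set \<open>\<S>(n,N)\<close>; the argument \<open>\<alpha> k j\<close> is the coefficient \<open>\<alpha>\<^sub>k(j)\<close>.\<close>

definition interp_solutions ::
    "nat \<Rightarrow> nat \<Rightarrow> (nat \<Rightarrow> complex) \<Rightarrow> (nat \<Rightarrow> nat \<Rightarrow> complex) \<Rightarrow> vec_poly set" where
  "interp_solutions n N z \<alpha> =
     {p \<in> vec_polys n. \<forall>j\<in>{1..N}. (\<Sum>k=1..n. \<alpha> k j * poly (p k) (z j)) = 0}"

definition cyclic_module :: "vec_poly \<Rightarrow> vec_poly set" where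
  "cyclic_module r = {vp_scale S r | S. True}"

text \<open>
  \<open>r 1, \<dots>, r n\<close> is a choice of first, \dots, \<open>n\<close>-th generators. The sum of sets is the
  elementwise (Minkowski) sum of \<^theory>\<open>HOL-Library.Set_Algebras\<close>.
\<close>

definition is_generators ::
    "nat \<Rightarrow> nat \<Rightarrow> (nat \<Rightarrow> complex) \<Rightarrow> (nat \<Rightarrow> nat \<Rightarrow> complex) \<Rightarrow> (nat \<Rightarrow> vec_poly) \<Rightarrow> bool" where
  "is_generators n N z \<alpha> r \<longleftrightarrow>
     r 1 \<in> interp_solutions n N z \<alpha> \<and>
     height n (r 1) = set_height n (interp_solutions n N z \<alpha>) \<and>
     (\<forall>j. 1 < j \<and> j \<le> n \<longrightarrow>
        r j \<in> interp_solutions n N z \<alpha> - (\<Sum>i=1..<j. cyclic_module (r i)) \<and>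
        height n (r j) =
          set_height n (interp_solutions n N z \<alpha> - (\<Sum>i=1..<j. cyclic_module (r i))))"

end

theory Submission
  imports Defs
begin

text \<open>
  Interleaving the coefficients of the components turns a vector polynomial into one sequence whose
  last nonzero position is the height, and on which multiplication by \<open>x ^ d\<close> acts as a shift by
  \<open>n * d\<close>. Hence whenever the heights of \<open>q\<close> and \<open>r\<close> agree modulo \<open>n\<close> and \<open>r\<close> is not higher than
  \<open>q\<close>, subtracting a monomial multiple of \<open>r\<close> lowers the height of \<open>q\<close>. By minimality the heights
  of the \<open>n\<close> generators are therefore distinct modulo \<open>n\<close>, so they represent all residues. A
  solution \<open>p\<close> is then reduced by the generator \<open>r j\<close> in its residue class; if \<open>p\<close> is lower than
  \<open>r j\<close>, minimality of \<open>r j\<close> already puts \<open>p\<close> into the span of the earlier generators.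
\<close>

section \<open>Interleaved coefficients, top positions and heights\<close>

definition flat_coeff :: "nat \<Rightarrow> vec_poly \<Rightarrow> nat \<Rightarrow> complex" where
  "flat_coeff n p m = coeff (p (m mod n + 1)) (m div n)"

text \<open>A relation rather than a function, since the zero vector polynomial has no top.\<close>

definition is_top :: "nat \<Rightarrow> vec_poly \<Rightarrow> nat \<Rightarrow> bool" where
  "is_top n p h \<longleftrightarrow> flat_coeff n p h \<noteq> 0 \<and> (\<forall>m>h. flat_coeff n p m = 0)"

definition span_on :: "(nat \<Rightarrow> vec_poly) \<Rightarrow> nat set \<Rightarrow> vec_poly set" where
  "span_on r I = {\<Sum>i\<in>I. vp_scale (S i) (r i) | S. True}"

lemma flat_coeff_index:
  assumes "j \<in> {1..n}"
  shows "flat_coeff n p (n * d + j - 1) = coeff (p j) d"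
proof -
  obtain i where i: "j = Suc i" "i < n"
    using assms by (cases j) auto
  then show ?thesis
    by (simp add: flat_coeff_def)
qed

lemma flat_coeff_diff: "flat_coeff n (p - q) m = flat_coeff n p m - flat_coeff n q m"
  by (simp add: flat_coeff_def)

text \<open>Adding \<open>n * d\<close> to a position keeps its residue modulo \<open>n\<close>,
  hence the component, and raises by \<open>d\<close> the degree at which the coefficient is
  read.\<close>

lemma flat_coeff_monom_scale:
  assumes "n \<ge> 1"
  shows "flat_coeff n (vp_scale (monom c d) p) (m + n * d) = c * flat_coeff n p m"
  using assms by (simp add: flat_coeff_def vp_scale_def coeff_monom_mult)

lemma is_top_unique: "is_top n p g \<Longrightarrow> is_top n p h \<Longrightarrow> g = h"
  unfolding is_top_def by (metis linorder_neqE_nat)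

lemma is_top_nonzero: "is_top n p h \<Longrightarrow> p \<noteq> 0"
  by (auto simp: is_top_def flat_coeff_def)

lemma ex_is_top:
  assumes "p \<in> vec_polys n" "p \<noteq> 0"
  shows "\<exists>h. is_top n p h"
proof -
  define A where "A = {m. flat_coeff n p m \<noteq> 0}"
  obtain j where j: "p j \<noteq> 0"
    using assms(2) by (auto simp: fun_eq_iff)
  then have jn: "j \<in> {1..n}"
    using assms(1) by (auto simp: vec_polys_def)
  then have "n * degree (p j) + j - 1 \<in> A"
    using j by (simp add: A_def flat_coeff_index del: One_nat_def)
  then have ne: "A \<noteq> {}"
    by blast
  \<comment> \<open>The sum of the degrees is a crude common bound: every position in
    \<open>A\<close> has quotient at most \<open>B\<close>.\<close>
  define B where "B = (\<Sum>j=1..n. degree (p j))"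
  have "A \<subseteq> {..<n * Suc B}"
  proof
    fix m assume "m \<in> A"
    then have "m div n \<le> degree (p (m mod n + 1))"
      by (simp add: A_def flat_coeff_def le_degree)
    also have "\<dots> \<le> B"
      unfolding B_def by (rule member_le_sum) (use jn in \<open>auto simp: Suc_le_eq\<close>)
    finally show "m \<in> {..<n * Suc B}"
      using jn by (simp add: div_less_iff_less_mult mult.commute flip: less_Suc_eq_le
          del: mult_Suc mult_Suc_right)
  qed
  then have fin: "finite A"
    using finite_subset by blast
  have "is_top n p (Max A)"
    unfolding is_top_def
    using Max_in[OF fin ne] Max_ge[OF fin] by (auto simp: A_def not_le[symmetric])
  then show ?thesis ..
qed

text \<open>The position \<open>n * d + j - 1\<close> of the coefficient of degree \<open>d\<close>
  in component \<open>j\<close> is the expression maximised in \<open>height\<close>, so the last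
  nonzero position is that maximum.\<close>

lemma height_is_top:
  assumes "n \<ge> 1" "is_top n p h"
  shows "height n p = ereal (real h)"
  unfolding height_def
proof (rule Max_eqI)
  fix y assume "y \<in> (\<lambda>j. ereal (real n) * ext_degree (p j) + ereal (real j) - 1) ` {1..n}"
  then obtain j where j: "j \<in> {1..n}"
    and y: "y = ereal (real n) * ext_degree (p j) + ereal (real j) - 1"
    by blast
  show "y \<le> ereal (real h)"
  proof (cases "p j = 0")
    case True
    have "-\<infinity> - (1 :: ereal) = -\<infinity>"
      unfolding one_ereal_def by (rule ereal_minus)
    then show ?thesis
      using True assms(1) by (simp add: y ext_degree_def)
  next
    case False
    then have "flat_coeff n p (n * degree (p j) + j - 1) \<noteq> 0"
      using j by (simp add: flat_coeff_index del: One_nat_def)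
    then have "n * degree (p j) + j - 1 \<le> h"
      using assms(2) unfolding is_top_def by (meson not_le)
    then have "n * degree (p j) + j \<le> h + 1"
      by linarith
    then have "real n * real (degree (p j)) + real j \<le> real h + 1"
      by (metis of_nat_1 of_nat_add of_nat_le_iff of_nat_mult)
    then show ?thesis
      using False by (simp add: y ext_degree_def one_ereal_def)
  qed
next
  define j where "j = h mod n + 1"
  have j: "j \<in> {1..n}"
    using assms(1) by (auto simp: j_def Suc_le_eq)
  have nz: "coeff (p j) (h div n) \<noteq> 0"
    using assms(2) by (simp add: is_top_def flat_coeff_def j_def)
  then have pj: "p j \<noteq> 0"
    by auto
  have "flat_coeff n p (n * degree (p j) + j - 1) \<noteq> 0"
    using pj j by (simp add: flat_coeff_index del: One_nat_def)
  then have "n * degree (p j) + j - 1 \<le> h"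
    using assms(2) unfolding is_top_def by (meson not_le)
  \<comment> \<open>As \<open>j - 1\<close> is the residue of \<open>h\<close>, this bounds the
    degree by the quotient \<open>h div n\<close>; the converse bound comes from
    \<open>nz\<close>.\<close>
  then have "n * degree (p j) \<le> n * (h div n)"
    using mult_div_mod_eq[of n h] unfolding j_def by linarith
  then have "degree (p j) = h div n"
    using nz assms(1) by (simp add: le_degree order_antisym)
  then have "n * degree (p j) + j = h + 1"
    by (simp add: j_def)
  then have "real n * real (degree (p j)) + real j = real h + 1"
    by (metis of_nat_1 of_nat_add of_nat_mult)
  then have "ereal (real h) = ereal (real n) * ext_degree (p j) + ereal (real j) - 1"
    using pj by (simp add: ext_degree_def one_ereal_def)
  with j show "ereal (real h) \<in>
      (\<lambda>j. ereal (real n) * ext_degree (p j) + ereal (real j) - 1) ` {1..n}"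
    by blast
qed simp

text \<open>Heights of nonzero elements are natural numbers, so the \<open>LEAST\<close> over the
  extended reals exists: it is the least top occurring in \<open>M\<close>.\<close>

lemma set_height_is_top:
  assumes "n \<ge> 1" "M \<subseteq> vec_polys n" "q \<in> M" "is_top n q g"
  shows "\<exists>h\<le>g. set_height n M = ereal (real h)"
proof -
  define P where "P h \<longleftrightarrow> (\<exists>q\<in>M. is_top n q h)" for h
  have Pg: "P g"
    using assms by (auto simp: P_def)
  have "set_height n M = ereal (real (Least P))"
    unfolding set_height_def
  proof (rule Least_equality)
    obtain q' where "q' \<in> M" "is_top n q' (Least P)"
      using LeastI[of P, OF Pg] P_def[of "Least P"] by blast
    then show "ereal (real (Least P)) \<in> height n ` (M - {0})"
      using assms(1) is_top_nonzero
      by (intro image_eqI[of _ _ q']) (auto simp: height_is_top)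
  next
    fix y assume "y \<in> height n ` (M - {0})"
    then obtain q' where q': "q' \<in> M" "q' \<noteq> 0" "y = height n q'"
      by blast
    then obtain h where h: "is_top n q' h"
      using assms(2) ex_is_top by blast
    then have "Least P \<le> h"
      using q' by (intro Least_le) (auto simp: P_def)
    then show "ereal (real (Least P)) \<le> y"
      using q' h assms(1) by (simp add: height_is_top)
  qed
  then show ?thesis
    using Least_le[of P, OF Pg] by blast
qed

text \<open>The hypothesis \<open>q \<in> M\<close> rules out the case of \<open>M \<subseteq> {0}\<close>, where the set height is junk.\<close>

lemma set_height_attained_le:
  assumes "n \<ge> 1" "M \<subseteq> vec_polys n" "r \<in> vec_polys n" "height n r = set_height n M"
    and "q \<in> M" "is_top n q g"
  shows "\<exists>h\<le>g. is_top n r h"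
proof -
  obtain h where h: "h \<le> g" "height n r = ereal (real h)"
    using set_height_is_top[OF assms(1,2,5,6)] assms(4) by auto
  then have "r \<noteq> 0"
    using height_zero[OF assms(1)] by auto
  then obtain h' where "is_top n r h'"
    using ex_is_top assms(3) by blast
  with h show ?thesis
    using height_is_top[OF assms(1)] by auto
qed

section \<open>Polynomial combinations of generators and reduction of the top\<close>

lemma sum_fun_apply: "(\<Sum>i\<in>I. f i) k = (\<Sum>i\<in>I. f i k)"
  for f :: "'i \<Rightarrow> 'a \<Rightarrow> 'b::comm_monoid_add"
  by (induction I rule: infinite_finite_induct) auto

lemma vp_scale_add_left: "vp_scale (S + T) p = vp_scale S p + vp_scale T p"
  by (simp add: vp_scale_def fun_eq_iff algebra_simps)

lemma vp_scale_0_left [simp]: "vp_scale 0 p = 0"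
  by (simp add: vp_scale_def fun_eq_iff)

lemma zero_in_span_on: "0 \<in> span_on r I"
  by (auto simp: span_on_def intro!: exI[of _ "\<lambda>_. 0"])

lemma span_on_add:
  assumes "p \<in> span_on r I" "q \<in> span_on r I"
  shows "p + q \<in> span_on r I"
proof -
  obtain S T where "p = (\<Sum>i\<in>I. vp_scale (S i) (r i))" "q = (\<Sum>i\<in>I. vp_scale (T i) (r i))"
    using assms by (auto simp: span_on_def)
  then have "p + q = (\<Sum>i\<in>I. vp_scale (S i + T i) (r i))"
    by (simp add: vp_scale_add_left sum.distrib)
  then show ?thesis
    by (auto simp: span_on_def)
qed

lemma span_on_mono:
  assumes "I \<subseteq> J" "finite J"
  shows "span_on r I \<subseteq> span_on r J"
proof
  fix p assume "p \<in> span_on r I"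
  then obtain S where "p = (\<Sum>i\<in>I. vp_scale (S i) (r i))"
    by (auto simp: span_on_def)
  also have "\<dots> = (\<Sum>i\<in>J. vp_scale (if i \<in> I then S i else 0) (r i))"
    using assms by (intro sum.mono_neutral_cong_left) auto
  finally show "p \<in> span_on r J"
    unfolding span_on_def by (intro CollectI exI[of _ "\<lambda>i. if i \<in> I then S i else 0"]) simp
qed

lemma vp_scale_in_span_on:
  assumes "i \<in> I" "finite I"
  shows "vp_scale S (r i) \<in> span_on r I"
proof -
  have "vp_scale S (r i) \<in> span_on r {i}"
    by (auto simp: span_on_def)
  then show ?thesis
    using span_on_mono[of "{i}" I r] assms by auto
qed

text \<open>Links the Minkowski sum in \<open>is_generators\<close> to
  \<open>span_on\<close>.\<close>

lemma sum_cyclic_module: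
  assumes "finite I"
  shows "(\<Sum>i\<in>I. cyclic_module (r i)) = span_on r I"
proof -
  have "(\<exists>s. p = sum s I \<and> (\<forall>i\<in>I. \<exists>S. s i = vp_scale S (r i))) \<longleftrightarrow>
      (\<exists>S. p = (\<Sum>i\<in>I. vp_scale (S i) (r i)))" for p
  proof
    assume "\<exists>s. p = sum s I \<and> (\<forall>i\<in>I. \<exists>S. s i = vp_scale S (r i))"
    then obtain s S where "p = sum s I" "\<And>i. i \<in> I \<Longrightarrow> s i = vp_scale (S i) (r i)"
      by metis
    then show "\<exists>S. p = (\<Sum>i\<in>I. vp_scale (S i) (r i))"
      by auto
  next
    assume "\<exists>S. p = (\<Sum>i\<in>I. vp_scale (S i) (r i))"
    then obtain S where "p = (\<Sum>i\<in>I. vp_scale (S i) (r i))" ..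
    then show "\<exists>s. p = sum s I \<and> (\<forall>i\<in>I. \<exists>S. s i = vp_scale S (r i))"
      by (intro exI[of _ "\<lambda>i. vp_scale (S i) (r i)"]) auto
  qed
  then show ?thesis
    using assms by (simp add: set_sum_alt cyclic_module_def span_on_def)
qed

text \<open>The conclusion bounds any top of the difference, because the difference may vanish and
  then has none.\<close>

lemma reduce_top:
  assumes "n \<ge> 1" "is_top n q g" "is_top n r h" "h \<le> g" "h mod n = g mod n"
  shows "\<exists>S. \<forall>m. is_top n (q - vp_scale S r) m \<longrightarrow> m < g"
proof -
  obtain d where d: "g = h + n * d"
    using assms(4,5) by (metis mod_eq_dvd_iff_nat dvdE le_add_diff_inverse)
  define c where "c = flat_coeff n q g / flat_coeff n r h"
  have "flat_coeff n (q - vp_scale (monom c d) r) m = 0" if "g \<le> m" for m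
  proof -
    define k where "k = m - n * d"
    have k: "m = k + n * d" "h \<le> k"
      using that d by (auto simp: k_def)
    have "flat_coeff n (q - vp_scale (monom c d) r) m = flat_coeff n q m - c * flat_coeff n r k"
      by (simp add: k(1) flat_coeff_diff flat_coeff_monom_scale[OF assms(1)])
    then show ?thesis
      \<comment> \<open>The case \<open>k = h\<close> is \<open>m = g\<close>, where
        \<open>c\<close> makes the two top coefficients cancel; beyond it both terms vanish.\<close>
      using assms(2,3) k d by (cases "k = h") (auto simp: c_def is_top_def)
  qed
  then show ?thesis
    unfolding is_top_def by (metis not_le)
qed

section \<open>Submodule structure of the solutions and the spanning argument\<close>

lemma interp_solutions_diff:
  assumes "p \<in> interp_solutions n N z \<alpha>" "q \<in> interp_solutions n N z \<alpha>"
  shows "p - q \<in> interp_solutions n N z \<alpha>"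
  using assms
  by (auto simp: interp_solutions_def vec_polys_def right_diff_distrib sum_subtractf)

lemma interp_solutions_scale:
  assumes "p \<in> interp_solutions n N z \<alpha>"
  shows "vp_scale S p \<in> interp_solutions n N z \<alpha>"
proof -
  have "(\<Sum>k=1..n. \<alpha> k j * poly (vp_scale S p k) (z j)) =
      poly S (z j) * (\<Sum>k=1..n. \<alpha> k j * poly (p k) (z j))" for j
    by (simp add: vp_scale_def sum_distrib_left mult_ac)
  then show ?thesis
    using assms by (auto simp: interp_solutions_def vec_polys_def vp_scale_def)
qed

text \<open>Stated for any submodule \<open>T\<close>, with minimality phrased through tops so that
  no extended reals occur.\<close>

lemma minimal_generators_span:
  assumes n: "n \<ge> 1" and T: "T \<subseteq> vec_polys n"
    and T_diff: "\<And>p q. p \<in> T \<Longrightarrow> q \<in> T \<Longrightarrow> p - q \<in> T"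
    and T_scale: "\<And>S p. p \<in> T \<Longrightarrow> vp_scale S p \<in> T"
    and r: "\<And>j. j \<in> {1..n} \<Longrightarrow> r j \<in> T - span_on r {1..<j}"
    and r_min: "\<And>j q g. j \<in> {1..n} \<Longrightarrow> q \<in> T - span_on r {1..<j} \<Longrightarrow> is_top n q g
      \<Longrightarrow> \<exists>h\<le>g. is_top n (r j) h"
    and p: "p \<in> T"
  shows "p \<in> span_on r {1..n}"
proof -
  have "\<exists>h. is_top n (r j) h" if "j \<in> {1..n}" for j
    using r[OF that] T zero_in_span_on[of r "{1..<j}"] by (intro ex_is_top) auto
  then obtain H where H: "\<And>j. j \<in> {1..n} \<Longrightarrow> is_top n (r j) (H j)"
    by metis
  have H_le: "H j \<le> g" if "j \<in> {1..n}" "q \<in> T - span_on r {1..<j}" "is_top n q g" for j q g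
    using r_min[OF that] H[OF that(1)] is_top_unique by blast
  have distinct: "H i mod n \<noteq> H j mod n" if ij: "i \<in> {1..n}" "j \<in> {1..n}" "i < j" for i j
  proof
    assume eq: "H i mod n = H j mod n"
    have rj: "r j \<in> T" "r j \<notin> span_on r {1..<j}"
      using r ij by auto
    \<comment> \<open>The spans grow with the index, so \<open>r j\<close> was already a candidate
      for the \<open>i\<close>-th generator and minimality of \<open>r i\<close> applies to
      it.\<close>
    have "r j \<notin> span_on r {1..<i}"
      using rj span_on_mono[of "{1..<i}" "{1..<j}" r] ij by auto
    then have "H i \<le> H j"
      using H_le[of i] H ij rj by auto
    then obtain S where S: "\<And>m. is_top n (r j - vp_scale S (r i)) m \<Longrightarrow> m < H j"
      using reduce_top[OF n H[of j] H[of i]] ij eq by blast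
    define q where "q = r j - vp_scale S (r i)"
    have q: "q \<in> T"
      using T_diff T_scale r ij by (auto simp: q_def)
    \<comment> \<open>Adding the multiple of the earlier \<open>r i\<close> back would put
      \<open>r j\<close> into the span. Hence \<open>q\<close> is a candidate for the
      \<open>j\<close>-th generator that is lower than \<open>r j\<close>.\<close>
    have q': "q \<notin> span_on r {1..<j}"
    proof
      assume "q \<in> span_on r {1..<j}"
      then have "q + vp_scale S (r i) \<in> span_on r {1..<j}"
        using ij by (intro span_on_add vp_scale_in_span_on) auto
      then show False
        using rj by (simp add: q_def)
    qed
    have "q \<noteq> 0"
      using q' zero_in_span_on by auto
    then obtain g where "is_top n q g"
      using ex_is_top q T by blast
    then show False
      using H_le[of j q g] S[of g] q q' ij by (auto simp: q_def)
  qed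
  then have "inj_on (\<lambda>j. H j mod n) {1..n}"
    by (intro linorder_inj_onI) auto
  \<comment> \<open>By counting: \<open>n\<close> distinct residues modulo \<open>n\<close> are all
    of them.\<close>
  then have residues: "(\<lambda>j. H j mod n) ` {1..n} = {..<n}"
    using n by (intro card_subset_eq) (auto simp: card_image)
  have "q \<in> T \<Longrightarrow> is_top n q g \<Longrightarrow> q \<in> span_on r {1..n}" for q g
  proof (induction g arbitrary: q rule: less_induct)
    case (less g)
    have "g mod n \<in> (\<lambda>j. H j mod n) ` {1..n}"
      using n residues by simp
    then obtain j where j: "j \<in> {1..n}" "H j mod n = g mod n"
      by auto
    show ?case
    proof (cases "H j \<le> g")
      case False
      then have "q \<in> span_on r {1..<j}"
        using H_le[OF j(1)] less.prems by blast
      moreover have "{1..<j} \<subseteq> {1..n}"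
        using j by auto
      ultimately show ?thesis
        using span_on_mono by blast
    next
      case True
      then obtain S where S: "\<And>m. is_top n (q - vp_scale S (r j)) m \<Longrightarrow> m < g"
        using reduce_top[OF n less.prems(2) H[OF j(1)]] j by blast
      define q' where "q' = q - vp_scale S (r j)"
      have q': "q' \<in> T"
        using T_diff T_scale r j less.prems by (auto simp: q'_def)
      have "q' \<in> span_on r {1..n}"
      proof (cases "q' = 0")
        case True
        then show ?thesis
          using zero_in_span_on by simp
      next
        case False
        then obtain m where "is_top n q' m"
          using ex_is_top q' T by blast
        then show ?thesis
          using less.IH[of m q'] S[of m] q' unfolding q'_def by blast
      qed
      then have "q' + vp_scale S (r j) \<in> span_on r {1..n}"
        using j by (intro span_on_add vp_scale_in_span_on) auto
      then show ?thesis
        by (simp add: q'_def)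
    qed
  qed
  then show ?thesis
    using p T ex_is_top zero_in_span_on by (cases "p = 0") blast+
qed

theorem theorem5p3:
  fixes n N :: nat
    and z :: "nat \<Rightarrow> complex"
    and \<alpha> :: "nat \<Rightarrow> nat \<Rightarrow> complex"
    and r :: "nat \<Rightarrow> vec_poly"
    and p :: vec_poly
  assumes "n \<ge> 2" and "N \<ge> 1"
    and "\<And>j. j \<in> {1..N} \<Longrightarrow> (\<Sum>k=1..n. cmod (\<alpha> k j)) > 0"
    and "\<And>w. lin_indep_family n {j \<in> {1..N}. z j = w} (\<lambda>j k. \<alpha> k j)"
    and "is_generators n N z \<alpha> r"
    and "p \<in> interp_solutions n N z \<alpha>"
  shows "\<exists>S :: nat \<Rightarrow> complex poly. p = (\<Sum>j=1..n. vp_scale (S j) (r j))"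
proof -
  define T where "T = interp_solutions n N z \<alpha>"
  have n: "n \<ge> 1"
    using assms(1) by simp
  have T: "T \<subseteq> vec_polys n"
    by (auto simp: T_def interp_solutions_def)
  have "p \<in> span_on r {1..n}"
  \<comment> \<open>A nonzero \<open>p\<close> shows that there are nonzero solutions, so the height
    prescribed for \<open>r 1\<close> is a genuine minimum.\<close>
  proof (cases "p = 0")
    case True
    then show ?thesis
      using zero_in_span_on by simp
  next
    case False
    then obtain g where g: "is_top n p g"
      using ex_is_top T assms(6) unfolding T_def by blast
    have gen: "r j \<in> T" "height n (r j) = set_height n (T - span_on r {1..<j})"
      "r j \<notin> span_on r {1..<j}" if j: "j \<in> {1..n}" for j
    proof -
      have *: "r j \<in> T \<and> height n (r j) = set_height n (T - span_on r {1..<j}) \<and>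
        r j \<notin> span_on r {1..<j}"
      proof (cases "j = 1")
        case True
        have r1: "r 1 \<in> T" "height n (r 1) = set_height n T"
          using assms(5) by (auto simp: is_generators_def T_def)
        \<comment> \<open>The minimal height over the nonzero solutions is finite, unlike the height
          of \<open>0\<close>.\<close>
        have "r 1 \<noteq> 0"
          using set_height_attained_le[OF n T _ r1(2) _ g] r1 T assms(6) is_top_nonzero
          by (auto simp: T_def)
        \<comment> \<open>Since \<open>set_height\<close> discards \<open>0\<close> anyway, removing
          this span from \<open>T\<close> leaves the minimum unchanged.\<close>
        moreover have "span_on r {1..<1} = {0}"
          by (simp add: span_on_def)
        ultimately show ?thesis
          using True r1 by (simp add: set_height_def)
      next
        case False
        then have "1 < j" "j \<le> n"
          using j by auto
        then show ?thesis
          using assms(5) by (auto simp: is_generators_def T_def sum_cyclic_module)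
      qed
      show "r j \<in> T" "height n (r j) = set_height n (T - span_on r {1..<j})"
        "r j \<notin> span_on r {1..<j}"
        using * by auto
    qed
    show ?thesis
    proof (rule minimal_generators_span[OF n T])
      show "p \<in> T"
        using assms(6) by (simp add: T_def)
      show "\<exists>h\<le>g. is_top n (r j) h"
        if "j \<in> {1..n}" "q \<in> T - span_on r {1..<j}" "is_top n q g" for j q g
        using set_height_attained_le[OF n _ _ gen(2)[OF that(1)] that(2,3)] gen(1)[OF that(1)] T
        by blast
    qed (use gen in \<open>auto simp: T_def interp_solutions_diff interp_solutions_scale\<close>)
  qed
  then show ?thesis
    by (auto simp: span_on_def)
qed

end
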